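(* Fix an integer $m\ge2$. For $n\ge0$ let $A^{(m)}_n$ be the number of ways to tile an $n$-board using squares and $(1,m-1)$-fences. Then for all integers $n\ge0$ and $r\in\{0,1,\dots,m-1\}$, \[ A^{(m)}_{mn+r}=f_n^{\,m-r}f_{n+1}^{\,r}, \] where $f_n=F_{n+1}$ and $F_k$ is the $k$th Fibonacci number.
   Context: An $n$-board is a $1\times n$ row of $n$ unit cells. A square is a $1\times1$ tile. A $(1,m-1)$-fence is a tile consisting of two $1\times1$ posts separated by a gap of width $m-1$ cells; placed on a board its posts occupy cells $i$ and $i+m$, and the gap cells are not covered by the fence (they must be covered by other tiles). A tiling covers every cell exactly once; the $0$-board has exactly one tiling. Fibonacci numbers: $F_0=0$, $F_1=1$, $F_k=F_{k-1}+F_{k-2}$. *)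

theory Defs
  imports "HOL-Number_Theory.Fib"
begin

text \<open>
  A tile already placed on a board, whose cells are numbered from 1. \<open>Fence i\<close> is the fence
  whose left post is on cell \<open>i\<close>; the gap parameter \<open>m\<close> is supplied to \<open>cells\<close>.
\<close>

datatype tile = Square nat | Fence nat

fun cells :: "nat \<Rightarrow> tile \<Rightarrow> nat set" where
  "cells m (Square i) = {i}"
| "cells m (Fence i) = {i, i + m}"

definition is_tiling :: "nat \<Rightarrow> nat \<Rightarrow> tile set \<Rightarrow> bool" where
  "is_tiling m n T \<longleftrightarrow>
     (\<forall>t\<in>T. cells m t \<subseteq> {1..n}) \<and> (\<forall>c\<in>{1..n}. \<exists>!t. t \<in> T \<and> c \<in> cells m t)"

definition num_tilings :: "nat \<Rightarrow> nat \<Rightarrow> nat" where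
  "num_tilings m n = card {T. is_tiling m n T}"

text \<open>The combinatorial indexing of the Fibonacci numbers: 1, 1, 2, 3, 5, \<dots>\<close>

definition fib_shift :: "nat \<Rightarrow> nat" where
  "fib_shift n = fib (n + 1)"

text \<open>The cardinality in \<open>num_tilings\<close> is that of a finite set, so it is a genuine count.\<close>

lemma finite_tilings: "finite {T. is_tiling m n T}"
proof -
  have "t \<in> Square ` {1..n} \<union> Fence ` {1..n}" if "cells m t \<subseteq> {1..n}" for t
    using that by (cases t) auto
  then have "{T. is_tiling m n T} \<subseteq> Pow (Square ` {1..n} \<union> Fence ` {1..n})"
    unfolding is_tiling_def by blast
  then show ?thesis
    by (rule finite_subset) simp
qed

lemma is_tiling_0_iff: "is_tiling m 0 T \<longleftrightarrow> T = {}"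
proof -
  have "cells m t \<noteq> {}" for t
    by (cases t) auto
  then show ?thesis
    unfolding is_tiling_def by auto
qed

end

theory Submission
  imports Defs "HOL-Library.FuncSet"
begin

text \<open>
  A tiling is determined by the set of left posts of its fences, and such a set is
  admissible iff no two of its elements differ by \<open>m\<close>. This constraint only relates cells in the
  same residue class modulo \<open>m\<close>, so the count is a product over the residue classes. Within
  one class the admissible sets are those without two consecutive elements, which are counted by
  the Fibonacci numbers.
\<close>

text \<open>Elements count from 0, unlike board cells, so that \<open>div\<close> and
  \<open>mod\<close> by \<open>m\<close> act on them directly. For \<open>m = 1\<close> these are
  the independent sets of a path on \<open>k\<close> vertices.\<close>

definition separated_sets :: "nat \<Rightarrow> nat \<Rightarrow> nat set set" where
  "separated_sets m k = {S. S \<subseteq> {..<k} \<and> (\<forall>i\<in>S. i + m \<notin> S)}"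

lemma finite_separated_sets: "finite (separated_sets m k)"
  by (rule finite_subset[of _ "Pow {..<k}"]) (auto simp: separated_sets_def)

text \<open>Split on the top element \<open>Suc k\<close>: if it is present, \<open>k\<close> is
  excluded and the rest lies below \<open>k\<close>. This gives the Fibonacci recurrence.\<close>

lemma separated_sets_1_Suc_Suc:
  "separated_sets (Suc 0) (Suc (Suc k)) =
     separated_sets (Suc 0) (Suc k) \<union> insert (Suc k) ` separated_sets (Suc 0) k"
proof (intro equalityI subsetI)
  fix S assume S: "S \<in> separated_sets (Suc 0) (Suc (Suc k))"
  show "S \<in> separated_sets (Suc 0) (Suc k) \<union> insert (Suc k) ` separated_sets (Suc 0) k"
  proof (cases "Suc k \<in> S")
    case True
    have "i < k" if "i \<in> S - {Suc k}" for i
    proof -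
      have "i < Suc (Suc k)" "i \<noteq> k"
        using S that True by (auto simp: separated_sets_def)
      with that show ?thesis by auto
    qed
    then have "S - {Suc k} \<in> separated_sets (Suc 0) k"
      using S by (auto simp: separated_sets_def)
    moreover have "S = insert (Suc k) (S - {Suc k})"
      using True by auto
    ultimately show ?thesis by blast
  next
    case False
    then have "i < Suc k" if "i \<in> S" for i
      using S that by (metis (mono_tags, lifting) lessThan_iff less_SucE
          mem_Collect_eq separated_sets_def subsetD)
    then show ?thesis
      using S by (auto simp: separated_sets_def)
  qed
qed (auto simp: separated_sets_def)

lemma card_separated_sets_1: "card (separated_sets (Suc 0) k) = fib (k + 2)"
proof (induction k rule: fib.induct)
  case 1
  have "separated_sets (Suc 0) 0 = {{}}"
    by (auto simp: separated_sets_def)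
  then show ?case by simp
next
  case 2
  have "separated_sets (Suc 0) (Suc 0) = {{}, {0}}"
    by (auto simp: separated_sets_def)
  then show ?case by (simp add: numeral_eq_Suc)
next
  case (3 k)
  \<comment> \<open>Sets from either smaller family miss \<open>Suc k\<close>, so the union is
    disjoint and the insertion injective.\<close>
  have "separated_sets (Suc 0) (Suc k) \<inter> insert (Suc k) ` separated_sets (Suc 0) k = {}"
    by (auto simp: separated_sets_def)
  moreover have "inj_on (insert (Suc k)) (separated_sets (Suc 0) k)"
  proof (rule inj_onI)
    fix S S' assume "S \<in> separated_sets (Suc 0) k" "S' \<in> separated_sets (Suc 0) k"
    then have "Suc k \<notin> S" "Suc k \<notin> S'"
      by (auto simp: separated_sets_def)
    then show "insert (Suc k) S = insert (Suc k) S' \<Longrightarrow> S = S'"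
      by (simp add: insert_ident)
  qed
  ultimately show ?case
    using 3 by (simp add: separated_sets_1_Suc_Suc card_Un_disjoint finite_separated_sets card_image)
qed

text \<open>The tiling is rebuilt by filling all cells left free by the fences with squares.
  The bijection shifts by one, since board cells are numbered from 1.\<close>

lemma num_tilings_eq_card_separated_sets:
  assumes "m > 0"
  shows "num_tilings m N = card (separated_sets m (N - m))"
proof -
  define f where "f T = {i. Fence (Suc i) \<in> T}" for T
  define g where "g S = Fence ` Suc ` S \<union>
    Square ` {c \<in> {1..N}. c \<notin> Suc ` S \<and> c \<notin> (\<lambda>i. Suc i + m) ` S}" for S
  have "bij_betw f {T. is_tiling m N T} (separated_sets m (N - m))"
  proof (rule bij_betw_byWitness[where f' = g])
    show "\<forall>T\<in>{T. is_tiling m N T}. g (f T) = T"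
    proof safe
      fix T t assume T: "is_tiling m N T"
      then have sub: "cells m t \<subseteq> {1..N}" if "t \<in> T" for t
        using that by (auto simp: is_tiling_def)
      have ex: "\<exists>t\<in>T. c \<in> cells m t" if "c \<in> {1..N}" for c
        using T that by (auto simp: is_tiling_def)
      have uniq: "t = t'" if "t \<in> T" "t' \<in> T" "c \<in> cells m t" "c \<in> cells m t'" for c t t'
        using T that sub[of t] unfolding is_tiling_def by blast
      {
        assume t: "t \<in> g (f T)"
        show "t \<in> T"
        proof (cases t)
          case (Square c)
          with t have c: "c \<in> {1..N}" "c \<notin> Suc ` f T" "c \<notin> (\<lambda>i. Suc i + m) ` f T"
            by (auto simp: g_def)
          obtain u where u: "u \<in> T" "c \<in> cells m u"
            using ex c(1) by blast
          show ?thesis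
          proof (cases u)
            \<comment> \<open>This case is contradictory: \<open>c\<close> would be a post of a
              fence in \<open>T\<close>. The left post is a successor because cell 0 is off the
              board.\<close>
            case (Fence j)
            with u sub[of u] obtain i where "j = Suc i"
              by (cases j) auto
            with Fence u c show ?thesis
              by (auto simp: f_def)
          qed (use u Square in auto)
        qed (use t in \<open>auto simp: g_def f_def\<close>)
      next
        assume t: "t \<in> T"
        show "t \<in> g (f T)"
        proof (cases t)
          case (Square c)
          have "Fence j \<notin> T" if "c \<in> cells m (Fence j)" for j
            using uniq[of t "Fence j" c] t that Square by auto
          then show ?thesis
            using sub[OF t] Square by (auto simp: g_def f_def)
        next
          case (Fence j)
          with sub[OF t] obtain i where "j = Suc i"
            by (cases j) auto
          with Fence t show ?thesis
            by (auto simp: g_def f_def)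
        qed
      }
    qed
    show "\<forall>S\<in>separated_sets m (N - m). f (g S) = S"
      by (auto simp: f_def g_def)
    show "f ` {T. is_tiling m N T} \<subseteq> separated_sets m (N - m)"
    proof safe
      fix T assume T: "is_tiling m N T"
      \<comment> \<open>The right post \<open>Suc i + m\<close> is at most \<open>N\<close>, which
        also makes the truncated subtraction harmless.\<close>
      have "i < N - m" if "Fence (Suc i) \<in> T" for i
        using T that by (force simp: is_tiling_def)
      \<comment> \<open>Otherwise the right post of one fence would be the left post of the
        other.\<close>
      moreover have "Fence (Suc (i + m)) \<notin> T" if i: "Fence (Suc i) \<in> T" for i
      proof
        assume *: "Fence (Suc (i + m)) \<in> T"
        have "Suc (i + m) \<in> {1..N}"
          using T * by (force simp: is_tiling_def)
        then have "\<exists>!t. t \<in> T \<and> Suc (i + m) \<in> cells m t"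
          using T by (auto simp: is_tiling_def)
        then have "Fence (Suc i) = Fence (Suc (i + m))"
          using i * by (metis add_Suc cells.simps(2) insert_iff)
        with assms show False by simp
      qed
      ultimately show "f T \<in> separated_sets m (N - m)"
        by (auto simp: f_def separated_sets_def)
    qed
    show "g ` separated_sets m (N - m) \<subseteq> {T. is_tiling m N T}"
    proof safe
      fix S assume "S \<in> separated_sets m (N - m)"
      then have S: "i < N - m" "i + m \<notin> S" if "i \<in> S" for i
        using that by (auto simp: separated_sets_def)
      show "is_tiling m N (g S)"
        unfolding is_tiling_def
      proof (intro conjI ballI)
        fix t assume "t \<in> g S"
        then show "cells m t \<subseteq> {1..N}"
          by (auto simp: g_def dest!: S(1))
      next
        fix c assume c: "c \<in> {1..N}"
        consider i where "i \<in> S" "c = Suc i" | i where "i \<in> S" "c = Suc i + m"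
          | "c \<notin> Suc ` S" "c \<notin> (\<lambda>i. Suc i + m) ` S"
          by blast
        then show "\<exists>!t. t \<in> g S \<and> c \<in> cells m t"
        proof cases
          case (1 i)
          then show ?thesis
            by (intro ex1I[of _ "Fence (Suc i)"]) (auto simp: g_def dest: S(2))
        next
          case (2 i)
          then show ?thesis
            by (intro ex1I[of _ "Fence (Suc i)"]) (auto simp: g_def dest: S(2))
        next
          case 3
          then show ?thesis
            using c by (intro ex1I[of _ "Square c"]) (auto simp: g_def)
        qed
      qed
    qed
  qed
  then show ?thesis
    by (simp add: num_tilings_def bij_betw_same_card)
qed

text \<open>Here \<open>l c\<close> is the size of the class of \<open>c\<close> modulo
  \<open>m\<close> in \<open>{..<k}\<close>. Writing elements as \<open>m * j + c\<close> turns a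
  difference of \<open>m\<close> into a difference of 1 in \<open>j\<close>, and choices in distinct
  classes are independent.\<close>

lemma card_separated_sets_residues:
  assumes m: "m > 0" and k: "\<And>c j. c < m \<Longrightarrow> m * j + c < k \<longleftrightarrow> j < l c"
  shows "card (separated_sets m k) = (\<Prod>c<m. card (separated_sets (Suc 0) (l c)))"
proof -
  \<comment> \<open>Restricting to \<open>{..<m}\<close> makes \<open>f S\<close> extensional, as
    membership in \<open>PiE\<close> requires.\<close>
  define f where "f S = (\<lambda>c\<in>{..<m}. {j. m * j + c \<in> S})" for S :: "nat set"
  define g where "g X = {i. i div m \<in> X (i mod m)}" for X :: "nat \<Rightarrow> nat set"
  have "bij_betw f (separated_sets m k) (\<Pi>\<^sub>E c\<in>{..<m}. separated_sets (Suc 0) (l c))"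
  proof (rule bij_betw_byWitness[where f' = g])
    show "\<forall>S\<in>separated_sets m k. g (f S) = S"
      using m by (auto simp: f_def g_def)
    show "\<forall>X\<in>\<Pi>\<^sub>E c\<in>{..<m}. separated_sets (Suc 0) (l c). f (g X) = X"
      using m by (auto simp: f_def g_def fun_eq_iff PiE_def extensional_def)
    show "f ` separated_sets m k \<subseteq> (\<Pi>\<^sub>E c\<in>{..<m}. separated_sets (Suc 0) (l c))"
    proof (rule image_subsetI)
      fix S assume S: "S \<in> separated_sets m k"
      have "{j. m * j + c \<in> S} \<in> separated_sets (Suc 0) (l c)" if "c < m" for c
      proof -
        have "j < l c" "m * Suc j + c \<notin> S" if "m * j + c \<in> S" for j
        proof -
          have "m * j + c < k" "m * j + c + m \<notin> S"
            using S that by (auto simp: separated_sets_def)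
          then show "j < l c" "m * Suc j + c \<notin> S"
            using k[OF \<open>c < m\<close>] by (auto simp: algebra_simps)
        qed
        then show ?thesis
          by (auto simp: separated_sets_def)
      qed
      then show "f S \<in> (\<Pi>\<^sub>E c\<in>{..<m}. separated_sets (Suc 0) (l c))"
        by (auto simp: f_def)
    qed
    show "g ` (\<Pi>\<^sub>E c\<in>{..<m}. separated_sets (Suc 0) (l c)) \<subseteq> separated_sets m k"
    proof safe
      fix X assume X: "X \<in> (\<Pi>\<^sub>E c\<in>{..<m}. separated_sets (Suc 0) (l c))"
      have "i < k \<and> i + m \<notin> g X" if "i \<in> g X" for i
      proof -
        have "X (i mod m) \<in> separated_sets (Suc 0) (l (i mod m))"
          using X m by (auto simp: PiE_def)
        then have "i div m < l (i mod m)" "Suc (i div m) \<notin> X (i mod m)"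
          using that by (auto simp: g_def separated_sets_def)
        \<comment> \<open>Adding \<open>m\<close> keeps the residue and raises the quotient by
          one.\<close>
        then show ?thesis
          using k[of "i mod m" "i div m"] m by (auto simp: g_def)
      qed
      then show "g X \<in> separated_sets m k"
        by (auto simp: separated_sets_def)
    qed
  qed
  then show ?thesis
    by (simp add: bij_betw_same_card card_PiE)
qed

theorem theorem2p4:
  fixes m n r :: nat
  assumes "m \<ge> 2" and "r \<in> {0..m - 1}"
  shows "num_tilings m (m * n + r) = fib_shift n ^ (m - r) * fib_shift (n + 1) ^ r"
proof -
  have m: "m > 0" and r: "r < m"
    using assms by auto
  \<comment> \<open>For \<open>n > 0\<close> the bound is \<open>m * (n - 1) + r\<close>:
    \<open>n - 1\<close> full rows of length \<open>m\<close>, then a partial row with the residues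
    below \<open>r\<close>.\<close>
  define l where "l c = (if c < r then n else n - 1)" for c
  have "m * j + c < m * n + r - m \<longleftrightarrow> j < l c" if c: "c < m" for c j
  proof (cases "j < n")
    case True
    \<comment> \<open>The bound becomes \<open>m * (j + d) + r\<close>; only for
      \<open>d = 0\<close>, the partial row, does \<open>c < r\<close> matter.\<close>
    then obtain d where "n = Suc (j + d)"
      using less_iff_Suc_add by auto
    then show ?thesis
      using c r by (cases d) (auto simp: l_def algebra_simps)
  next
    case False
    then have "m * n \<le> m * j"
      by simp
    with r have "\<not> m * j + c < m * n + r - m"
      by linarith
    with False show ?thesis
      by (auto simp: l_def)
  qed
  then have "num_tilings m (m * n + r) = (\<Prod>c<m. card (separated_sets (Suc 0) (l c)))"
    using m by (simp add: num_tilings_eq_card_separated_sets card_separated_sets_residues)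
  also have "\<dots> = (\<Prod>c<m. if c < r then fib_shift (n + 1) else fib_shift n)"
    \<comment> \<open>For \<open>n = 0\<close> truncation gives \<open>l c = 0\<close> throughout,
      which still fits since \<open>fib 1 = fib 2\<close>.\<close>
    by (cases n) (auto intro!: prod.cong simp: card_separated_sets_1 l_def fib_shift_def)
  also have "\<dots> = (\<Prod>c<r. fib_shift (n + 1)) * (\<Prod>c\<in>{r..<m}. fib_shift n)"
  proof -
    have "{..<m} \<inter> {c. c < r} = {..<r}" "{..<m} \<inter> - {c. c < r} = {r..<m}"
      using r by auto
    then show ?thesis
      by (simp add: prod.If_cases)
  qed
  finally show ?thesis
    by (simp add: mult.commute)
qed

end
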